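(* Let $n\ge2$ be an integer, let $S\subset\{0,\dots,n-1\}$ with $|S|>n/2$, and let $$\mathfrak{S}=\{1\}\cup\{m\in\mathbb{Z}_{>0}: m=qn+r,\ r\in S,\ q\in\mathbb{Z}\}.$$ Start the discrete fragmentation process with stopping set $\mathfrak{S}$ from $R$ identical sticks of positive integer length $L\notin\mathfrak{S}$. If the base $B$ is greater than $3^{6n^3/|S|}$, then, as $R\to\infty$ and $L\to\infty$ with $R=\omega(L^2)$ (i.e. $R/L^2\to\infty$), the collection of base-$B$ mantissas of ending stick lengths does not converge to the uniform distribution on $[0,1]$.
   Context: For $B>1$ and $x>0$ the mantissa is $M_B(x)=\log_B x-\lfloor\log_B x\rfloor\in[0,1)$. Discrete fragmentation process with stopping set $\mathfrak{S}\subseteq\mathbb{Z}_{>0}$, started from $R$ sticks of integer length $L\notin\mathfrak{S}$: all starting sticks are alive. At each level, every living stick, of length $\ell$ say, is broken into two sticks of lengths $X$ and $\ell-X$, where $X$ is uniformly distributed on $\{1,\dots,\ell-1\}$, independently for different sticks. A new stick becomes dead (is never broken again) if its length is in $\mathfrak{S}$, and is alive otherwise. The process ends when all sticks are dead; the ending sticks are all the dead sticks. Convergence: let $(L_j,R_j)$ be a sequence with $L_j\notin\mathfrak{S}$, $L_j\to\infty$, $R_j/L_j^2\to\infty$, and let $Q_j(t)$ be the proportion of ending sticks (counted with multiplicity), for the process with parameters $L_j,R_j$, whose length has mantissa at most $t$. The mantissas converge to the uniform distribution if $\mathbb{E}[Q_j(t)]\to t$ and $\operatorname{Var}[Q_j(t)]\to0$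 for all $t\in[0,1]$. The theorem asserts that this fails along every such sequence. *)

theory Defs
  imports "HOL-Probability.Probability"
begin

definition mantissa :: "real \<Rightarrow> real \<Rightarrow> real" where
  "mantissa B x = frac (log B x)"

definition stopping_set :: "nat \<Rightarrow> nat set \<Rightarrow> nat set" where
  "stopping_set n S = {1} \<union> {m. m > 0 \<and> (\<exists>q::int. \<exists>r\<in>S. int m = q * int n + int r)}"

text \<open>
  A state of the process is the list of the lengths of all current sticks, dead ones included.
  Dead sticks (length in the stopping set) are kept unchanged. When 1 lies in the
  stopping set, a living stick of positive length has length at least 2, so the set
  of cutting points below is nonempty.
\<close>

definition break_stick :: "nat set \<Rightarrow> nat \<Rightarrow> nat list pmf" where
  "break_stick D l =
     (if l \<in> D then return_pmf [l] else map_pmf (\<lambda>x. [x, l - x]) (pmf_of_set {1..l - 1}))"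

primrec break_all :: "nat set \<Rightarrow> nat list \<Rightarrow> nat list pmf" where
  "break_all D [] = return_pmf []"
| "break_all D (l # ls) =
     bind_pmf (break_stick D l) (\<lambda>xs. bind_pmf (break_all D ls) (\<lambda>ys. return_pmf (xs @ ys)))"

primrec frag_level :: "nat set \<Rightarrow> nat \<Rightarrow> nat \<Rightarrow> nat \<Rightarrow> nat list pmf" where
  "frag_level D L R 0 = return_pmf (replicate R L)"
| "frag_level D L R (Suc k) = bind_pmf (frag_level D L R k) (break_all D)"

text \<open>
  Living sticks get strictly shorter at each level, so after \<open>L\<close> levels all sticks are dead
  and the state no longer changes (\<open>ending_sticks_dead\<close> and \<open>frag_level_ended\<close> below):
  the state at level \<open>L\<close> is the collection of ending sticks.
\<close>

definition ending_sticks :: "nat set \<Rightarrow> nat \<Rightarrow> nat \<Rightarrow> nat list pmf" where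
  "ending_sticks D L R = frag_level D L R L"

definition mantissa_proportion :: "real \<Rightarrow> real \<Rightarrow> nat list \<Rightarrow> real" where
  "mantissa_proportion B t xs =
     real (length (filter (\<lambda>l. mantissa B (real l) \<le> t) xs)) / real (length xs)"

definition mantissas_converge_to_uniform ::
    "real \<Rightarrow> nat set \<Rightarrow> (nat \<Rightarrow> nat) \<Rightarrow> (nat \<Rightarrow> nat) \<Rightarrow> bool" where
  "mantissas_converge_to_uniform B D L R \<longleftrightarrow>
     (\<forall>t\<in>{0..1}.
        (\<lambda>j. measure_pmf.expectation (ending_sticks D (L j) (R j)) (mantissa_proportion B t))
          \<longlonglongrightarrow> t \<and>
        (\<lambda>j. measure_pmf.variance (ending_sticks D (L j) (R j)) (mantissa_proportion B t))
          \<longlonglongrightarrow> 0)"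

lemma break_all_bound:
  assumes "1 \<in> D" "\<And>x. x \<in> set xs \<Longrightarrow> x \<in> D \<or> 0 < x \<and> x + k \<le> L"
    and "ys \<in> set_pmf (break_all D xs)" "y \<in> set ys"
  shows "y \<in> D \<or> 0 < y \<and> y + Suc k \<le> L"
  using assms(2-)
proof (induction xs arbitrary: ys)
  case Nil
  then show ?case by simp
next
  case (Cons l ls)
  from Cons.prems(2) obtain as bs where
    as: "as \<in> set_pmf (break_stick D l)" and bs: "bs \<in> set_pmf (break_all D ls)"
    and ys: "ys = as @ bs"
    by auto
  show ?case
  proof (cases "y \<in> set bs")
    case True
    then show ?thesis using Cons.IH[OF _ bs] Cons.prems(1) by auto
  next
    case False
    then have y: "y \<in> set as" using ys Cons.prems(3) by auto
    show ?thesis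
    proof (cases "l \<in> D")
      case True
      then show ?thesis using as y by (simp add: break_stick_def)
    next
      case False
      then have l: "0 < l" "l + k \<le> L" using Cons.prems(1)[of l] by auto
      have "l \<noteq> 1" using False assms(1) by auto
      with l have "1 \<in> {1..l - 1}" by auto
      then have ne: "{1..l - 1} \<noteq> {}" by blast
      obtain x where "x \<in> {1..l - 1}" "as = [x, l - x]"
        using as False set_pmf_of_set[OF ne] by (auto simp: break_stick_def)
      then show ?thesis using y l by auto
    qed
  qed
qed

lemma frag_level_bound:
  assumes "1 \<in> D" "0 < L" "xs \<in> set_pmf (frag_level D L R k)" "x \<in> set xs"
  shows "x \<in> D \<or> 0 < x \<and> x + k \<le> L"
  using assms(3,4)
proof (induction k arbitrary: xs x)
  case 0
  then show ?case using assms(2) by auto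
next
  case (Suc k)
  from Suc.prems(1) obtain ws where
    "ws \<in> set_pmf (frag_level D L R k)" "xs \<in> set_pmf (break_all D ws)"
    by auto
  then show ?case using break_all_bound[OF assms(1), of ws k L xs x] Suc.IH Suc.prems(2) by blast
qed

lemma ending_sticks_dead:
  assumes "1 \<in> D" "0 < L" "xs \<in> set_pmf (ending_sticks D L R)"
  shows "set xs \<subseteq> D"
  using frag_level_bound[OF assms(1,2), of xs R L] assms(3)
  unfolding ending_sticks_def by fastforce

lemma break_all_dead: "set xs \<subseteq> D \<Longrightarrow> break_all D xs = return_pmf xs"
  by (induction xs) (auto simp: break_stick_def bind_return_pmf)

lemma frag_level_ended:
  assumes "1 \<in> D" "0 < L"
  shows "frag_level D L R (L + k) = ending_sticks D L R"
proof (induction k)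
  case 0
  then show ?case by (simp add: ending_sticks_def)
next
  case (Suc k)
  have "bind_pmf (ending_sticks D L R) (break_all D) =
        bind_pmf (ending_sticks D L R) return_pmf"
    by (intro bind_pmf_cong refl break_all_dead ending_sticks_dead[OF assms])
  then show ?case using Suc by (simp add: bind_return_pmf')
qed

end

theory Submission imports Defs begin

text \<open>
  The obstruction is a lump of sticks of length comparable to \<open>L\<close>. Write \<open>s\<close> for the number of
  stopping residues. Each cut of a long stick kills, on average, a proportion about \<open>s / n > 1/2\<close>
  of the two new sticks, so the branching process of living sticks is subcritical and the
  expected number of ending sticks produced by one starting stick is bounded independently of
  \<open>L\<close>: it is at most \<open>C = 2 n\<^sup>2\<close> (\<open>expected_number_le\<close>). On the other hand, if \<open>L\<close> is large, already the first cut
  produces on average at least \<open>s / (2 n)\<close> dead sticks with length in \<open>(L/3, L]\<close>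
  (\<open>expected_number_top_third_ge\<close>). So one expects a proportion of at least
  \<open>s / (2 n C) = s / (4 n\<^sup>3)\<close> of the ending sticks in that window. The mantissas of the window
  lie on a circular arc of length \<open>log B 3\<close>, and the hypothesis on \<open>B\<close> says precisely that
  \<open>log B 3 < s / (6 n\<^sup>3)\<close>, so the arc receives more than its uniform share.

  Two limits have to be handled. The proportion is a quotient \<open>A / N\<close> of random counts, whereas the
  bounds above concern \<open>E A\<close> and \<open>E N\<close>. The convexity bound \<open>1 / N \<ge> 2 / \<mu> - N / \<mu>\<^sup>2\<close> at
  \<open>\<mu> = R C\<close> turns \<open>E (A / N)\<close> into \<open>E A\<close> and \<open>E (A N)\<close>; since the starting sticks evolve
  independently, \<open>E (A N)\<close> is \<open>E A * E N\<close> up to an error of order \<open>R L\<^sup>2\<close>, which is negligible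
  against \<open>\<mu>\<^sup>2\<close> because \<open>L\<^sup>2 / R\<close> tends to 0 (\<open>expected_proportion_ge\<close>). And the arc moves with
  \<open>L\<close>, so convergence of the distribution functions is needed uniformly in \<open>t\<close>; monotonicity gives
  this for free (\<open>monotone_converges_to_id_uniformly\<close>).
\<close>

section \<open>The process from an arbitrary collection of sticks\<close>

text \<open>
  Unlike \<open>frag_level\<close>, this recursion splits off the first level. Conditioning on the first cut is
  what gives a recursion in the length of a single stick.
\<close>
primrec frag_from :: "nat set \<Rightarrow> nat \<Rightarrow> nat list \<Rightarrow> nat list pmf" where
  "frag_from D 0 xs = return_pmf xs"
| "frag_from D (Suc k) xs = bind_pmf (break_all D xs) (frag_from D k)"

lemma frag_from_Suc_last:
  "frag_from D (Suc k) xs = bind_pmf (frag_from D k xs) (break_all D)"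
proof (induction k arbitrary: xs)
  case 0
  have "frag_from D 0 = return_pmf" by auto
  then show ?case by (simp add: bind_return_pmf bind_return_pmf')
next
  case (Suc k)
  have "frag_from D (Suc (Suc k)) xs = bind_pmf (break_all D xs) (frag_from D (Suc k))"
    by simp
  also have "\<dots> = bind_pmf (break_all D xs) (\<lambda>ys. bind_pmf (frag_from D k ys) (break_all D))"
    using Suc by presburger
  also have "\<dots> = bind_pmf (frag_from D (Suc k) xs) (break_all D)"
    by (simp add: bind_assoc_pmf)
  finally show ?case .
qed

lemma frag_level_eq_frag_from: "frag_level D L R k = frag_from D k (replicate R L)"
proof (induction k)
  case 0
  then show ?case by simp
next
  case (Suc k)
  then show ?case by (simp only: frag_level.simps frag_from_Suc_last)
qed

lemma break_all_append:
  "break_all D (xs @ ys) =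
     bind_pmf (break_all D xs) (\<lambda>a. bind_pmf (break_all D ys) (\<lambda>b. return_pmf (a @ b)))"
  by (induction xs) (simp_all add: bind_return_pmf bind_return_pmf' bind_assoc_pmf)

text \<open>
  Disjoint groups of sticks evolve independently. In the induction step the cuts of the second
  group have to be moved past the later levels of the first group, which is Fubini's theorem.
\<close>
lemma frag_from_append:
  "frag_from D k (xs @ ys) =
     bind_pmf (frag_from D k xs) (\<lambda>a. bind_pmf (frag_from D k ys) (\<lambda>b. return_pmf (a @ b)))"
proof (induction k arbitrary: xs ys)
  case 0
  then show ?case by (simp add: bind_return_pmf)
next
  case (Suc k)
  have "frag_from D (Suc k) (xs @ ys) =
      bind_pmf (break_all D xs) (\<lambda>a. bind_pmf (break_all D ys) (\<lambda>b.
        bind_pmf (frag_from D k a) (\<lambda>c. bind_pmf (frag_from D k b) (\<lambda>d. return_pmf (c @ d)))))"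
    by (simp add: break_all_append bind_assoc_pmf bind_return_pmf Suc)
  also have "\<dots> = bind_pmf (break_all D xs) (\<lambda>a. bind_pmf (frag_from D k a) (\<lambda>c.
        bind_pmf (break_all D ys) (\<lambda>b. bind_pmf (frag_from D k b) (\<lambda>d. return_pmf (c @ d)))))"
    by (subst bind_commute_pmf) (rule refl)
  also have "\<dots> = bind_pmf (frag_from D (Suc k) xs)
      (\<lambda>c. bind_pmf (frag_from D (Suc k) ys) (\<lambda>d. return_pmf (c @ d)))"
    by (simp add: bind_assoc_pmf)
  finally show ?case .
qed

lemma frag_from_Nil: "frag_from D k [] = return_pmf []"
  by (induction k) (simp_all add: bind_return_pmf)

lemma break_all_single: "break_all D [l] = break_stick D l"
  by (simp add: bind_return_pmf bind_return_pmf')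

lemma frag_from_single_dead: "l \<in> D \<Longrightarrow> frag_from D k [l] = return_pmf [l]"
  by (induction k) (simp_all add: break_stick_def bind_return_pmf)

lemma break_stick_support:
  assumes "1 \<in> D" "0 < l" "xs \<in> set_pmf (break_stick D l)"
  shows "sum_list xs = l \<and> 0 \<notin> set xs"
proof (cases "l \<in> D")
  case True
  then show ?thesis using assms by (auto simp: break_stick_def)
next
  case False
  then have "l \<noteq> 1" using assms(1) by auto
  with assms(2) have "1 \<in> {1..l - 1}" by auto
  then have "{1..l - 1} \<noteq> {}" by blast
  from set_pmf_of_set[OF this] show ?thesis
    using False assms by (auto simp: break_stick_def)
qed

text \<open>
  Conservation of the total length bounds the number of sticks (as no stick has length 0) and
  makes all supports finite, so that integrability is never an issue.
\<close>
lemma break_all_support: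
  assumes "1 \<in> D" "0 \<notin> set xs" "ys \<in> set_pmf (break_all D xs)"
  shows "sum_list ys = sum_list xs \<and> 0 \<notin> set ys"
  using assms(2,3)
proof (induction xs arbitrary: ys)
  case (Cons l ls)
  then obtain as bs where "as \<in> set_pmf (break_stick D l)" "bs \<in> set_pmf (break_all D ls)"
    "ys = as @ bs" by auto
  with Cons break_stick_support[OF assms(1), of l as] show ?case by fastforce
qed simp

lemma frag_from_support:
  assumes "1 \<in> D" "0 \<notin> set xs" "ys \<in> set_pmf (frag_from D k xs)"
  shows "sum_list ys = sum_list xs \<and> 0 \<notin> set ys"
  using assms(2,3)
proof (induction k arbitrary: xs)
  case (Suc k)
  then obtain zs where "zs \<in> set_pmf (break_all D xs)" "ys \<in> set_pmf (frag_from D k zs)"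
    by auto
  with Suc break_all_support[OF assms(1)] show ?case by metis
qed simp

lemma length_le_sum_list: "0 \<notin> set xs \<Longrightarrow> length xs \<le> sum_list xs" for xs :: "nat list"
  by (induction xs) auto

lemma finite_nat_lists_sum: "finite {xs :: nat list. 0 \<notin> set xs \<and> sum_list xs = m}"
proof (rule finite_subset)
  show "{xs :: nat list. 0 \<notin> set xs \<and> sum_list xs = m}
          \<subseteq> {xs. set xs \<subseteq> {..m} \<and> length xs \<le> m}"
    using length_le_sum_list member_le_sum_list by fastforce
qed (simp add: finite_lists_length_le)

lemma finite_break_all:
  "1 \<in> D \<Longrightarrow> 0 \<notin> set xs \<Longrightarrow> finite (set_pmf (break_all D xs))"
  by (rule finite_subset[OF _ finite_nat_lists_sum[of "sum_list xs"]])
     (use break_all_support in auto)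

lemma finite_frag_from:
  "1 \<in> D \<Longrightarrow> 0 \<notin> set xs \<Longrightarrow> finite (set_pmf (frag_from D k xs))"
  by (rule finite_subset[OF _ finite_nat_lists_sum[of "sum_list xs"]])
     (use frag_from_support in auto)

section \<open>Expected weights of the sticks\<close>

lemma expectation_bind_finite:
  fixes h :: "'b \<Rightarrow> real"
  assumes "finite (set_pmf p)" "\<And>x. x \<in> set_pmf p \<Longrightarrow> finite (set_pmf (f x))"
  shows "measure_pmf.expectation (bind_pmf p f) h =
         measure_pmf.expectation p (\<lambda>x. measure_pmf.expectation (f x) h)"
  by (subst pmf_expectation_bind[OF assms(1,2)])
     (auto simp: integral_measure_pmf[OF assms(1)])

abbreviation total_weight :: "(nat \<Rightarrow> real) \<Rightarrow> nat list \<Rightarrow> real" where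
  "total_weight w xs \<equiv> (\<Sum>x\<leftarrow>xs. w x)"

abbreviation frag_exp :: "nat set \<Rightarrow> nat \<Rightarrow> nat list \<Rightarrow> (nat list \<Rightarrow> real) \<Rightarrow> real" where
  "frag_exp D k xs h \<equiv> measure_pmf.expectation (frag_from D k xs) h"

lemma frag_exp_append:
  assumes "1 \<in> D" "0 \<notin> set xs" "0 \<notin> set ys"
  shows "frag_exp D k (xs @ ys) h = frag_exp D k xs (\<lambda>a. frag_exp D k ys (\<lambda>b. h (a @ b)))"
  unfolding frag_from_append using assms
  by (simp add: expectation_bind_finite finite_frag_from)

lemma integrable_frag_from:
  fixes h :: "nat list \<Rightarrow> real"
  assumes "1 \<in> D" "0 \<notin> set xs"
  shows "integrable (measure_pmf (frag_from D k xs)) h"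
  by (rule integrable_measure_pmf_finite) (rule finite_frag_from[OF assms])

lemma frag_exp_mono:
  assumes "1 \<in> D" "0 \<notin> set xs"
    and "\<And>ys. ys \<in> set_pmf (frag_from D k xs) \<Longrightarrow> g ys \<le> h ys"
  shows "frag_exp D k xs g \<le> frag_exp D k xs h"
  using assms by (intro integral_mono_AE integrable_frag_from) (auto simp: AE_measure_pmf_iff)

lemma frag_exp_total_append:
  assumes "1 \<in> D" "0 \<notin> set xs" "0 \<notin> set ys"
  shows "frag_exp D k (xs @ ys) (total_weight w) =
         frag_exp D k xs (total_weight w) + frag_exp D k ys (total_weight w)"
  using assms by (simp add: frag_exp_append integrable_frag_from)

lemma frag_exp_product_append:
  assumes "1 \<in> D" "0 \<notin> set xs" "0 \<notin> set ys"
  shows "frag_exp D k (xs @ ys) (\<lambda>zs. total_weight u zs * total_weight v zs) =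
         frag_exp D k xs (\<lambda>zs. total_weight u zs * total_weight v zs) +
         frag_exp D k xs (total_weight u) * frag_exp D k ys (total_weight v) +
         frag_exp D k xs (total_weight v) * frag_exp D k ys (total_weight u) +
         frag_exp D k ys (\<lambda>zs. total_weight u zs * total_weight v zs)"
  using assms by (simp add: frag_exp_append integrable_frag_from algebra_simps)

lemma frag_exp_total_replicate:
  assumes "1 \<in> D" "0 < L"
  shows "frag_exp D k (replicate R L) (total_weight w) = real R * frag_exp D k [L] (total_weight w)"
proof (induction R)
  case 0
  then show ?case by (simp add: frag_from_Nil)
next
  case (Suc R)
  have "frag_exp D k ([L] @ replicate R L) (total_weight w) =
        real (Suc R) * frag_exp D k [L] (total_weight w)"
    using assms Suc by (subst frag_exp_total_append) (auto simp: algebra_simps)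
  then show ?case by simp
qed

text \<open>
  By independence the mixed moments factor for the \<open>R (R - 1)\<close> ordered pairs of different starting
  sticks; only the \<open>R\<close> diagonal terms remain.
\<close>
lemma frag_exp_product_replicate:
  assumes "1 \<in> D" "0 < L"
  shows "frag_exp D k (replicate R L) (\<lambda>zs. total_weight u zs * total_weight v zs) =
         real R * frag_exp D k [L] (\<lambda>zs. total_weight u zs * total_weight v zs) +
         real R * (real R - 1) * (frag_exp D k [L] (total_weight u) * frag_exp D k [L] (total_weight v))"
proof (induction R)
  case 0
  then show ?case by (simp add: frag_from_Nil)
next
  case (Suc R)
  have "frag_exp D k ([L] @ replicate R L) (\<lambda>zs. total_weight u zs * total_weight v zs) =
     real (Suc R) * frag_exp D k [L] (\<lambda>zs. total_weight u zs * total_weight v zs) +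
     real (Suc R) * (real (Suc R) - 1) *
       (frag_exp D k [L] (total_weight u) * frag_exp D k [L] (total_weight v))"
    using assms Suc
    by (subst frag_exp_product_append) (auto simp: frag_exp_total_replicate algebra_simps)
  then show ?case by simp
qed

text \<open>
  The two pieces \<open>x\<close> and \<open>l - x\<close> of the first cut have the same distribution, whence the factor 2.
\<close>
lemma frag_exp_total_alive:
  assumes "1 \<in> D" "0 < l" "l \<notin> D"
  shows "frag_exp D (Suc k) [l] (total_weight w) =
         2 / real (l - 1) * (\<Sum>x = 1..l - 1. frag_exp D k [x] (total_weight w))"
proof -
  let ?G = "\<lambda>x. frag_exp D k [x] (total_weight w)"
  have "l \<noteq> 1" using assms by auto
  with assms(2) have "1 \<in> {1..l - 1}" by auto
  then have ne: "{1..l - 1} \<noteq> {}" by blast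
  have fin: "finite (set_pmf (frag_from D k ys))"
    if "ys \<in> set_pmf (break_stick D l)" for ys
    using that break_stick_support[OF assms(1,2)] by (intro finite_frag_from assms(1)) auto
  have pair: "frag_exp D k [x, l - x] (total_weight w) = ?G x + ?G (l - x)"
    if "x \<in> {1..l - 1}" for x
    using frag_exp_total_append[OF assms(1), of "[x]" "[l - x]"] that assms(2) by fastforce
  have "frag_exp D (Suc k) [l] (total_weight w) =
        measure_pmf.expectation (break_stick D l) (\<lambda>ys. frag_exp D k ys (total_weight w))"
    unfolding frag_from.simps break_all_single
    by (rule expectation_bind_finite)
       (use fin finite_break_all[OF assms(1), of "[l]"] assms(2) in \<open>auto simp: break_all_single bind_return_pmf bind_return_pmf'\<close>)
  also have "\<dots> = (\<Sum>x = 1..l - 1. frag_exp D k [x, l - x] (total_weight w)) / real (l - 1)"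
    using assms(3) ne by (simp add: break_stick_def integral_pmf_of_set)
  also have "(\<Sum>x = 1..l - 1. frag_exp D k [x, l - x] (total_weight w)) =
      (\<Sum>x = 1..l - 1. ?G x) + (\<Sum>x = 1..l - 1. ?G (l - x))"
    by (simp add: pair sum.distrib)
  also have "(\<Sum>x = 1..l - 1. ?G (l - x)) = (\<Sum>x = 1..l - 1. ?G x)"
    by (rule sum.reindex_bij_witness[where i = "\<lambda>x. l - x" and j = "\<lambda>x. l - x"]) auto
  finally show ?thesis by simp
qed

lemma frag_exp_total_dead:
  "l \<in> D \<Longrightarrow> frag_exp D k [l] (total_weight w) = w l"
  by (simp add: frag_from_single_dead)

section \<open>Residue classes\<close>

text \<open>Shifting the window by one exchanges \<open>a\<close> for \<open>a + n\<close>, which has the same residue.\<close>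
lemma sum_mod_window:
  fixes f :: "nat \<Rightarrow> real"
  assumes "0 < n"
  shows "(\<Sum>x = a..<a + n. f (x mod n)) = (\<Sum>x < n. f x)"
proof (induction a)
  case 0
  then show ?case by (auto simp: atLeast0LessThan)
next
  case (Suc a)
  have "(\<Sum>x = a..<a + n. f (x mod n)) = f (a mod n) + (\<Sum>x = Suc a..<a + n. f (x mod n))"
    using assms by (intro sum.atLeast_Suc_lessThan) simp
  moreover have "(\<Sum>x = Suc a..<Suc a + n. f (x mod n)) =
      (\<Sum>x = Suc a..<a + n. f (x mod n)) + f ((a + n) mod n)"
    using assms by simp
  ultimately show ?case using Suc by simp
qed

lemma sum_residues_window:
  assumes "0 < n" "S \<subseteq> {0..n - 1}"
  shows "(\<Sum>x = a..<a + q * n. of_bool (x mod n \<in> S)) = real q * real (card S)"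
proof (induction q)
  case (Suc q)
  have "{..<n} \<inter> S = S" using assms by fastforce
  then have one: "(\<Sum>x = a + q * n..<(a + q * n) + n. of_bool (x mod n \<in> S)) = real (card S)"
    using assms sum_mod_window[of n "\<lambda>r. of_bool (r \<in> S)" "a + q * n"] by (simp add: sum.If_cases of_bool_def)
  have "(\<Sum>x = a..<a + Suc q * n. of_bool (x mod n \<in> S) :: real) =
    (\<Sum>x = a..<a + q * n. of_bool (x mod n \<in> S)) +
    (\<Sum>x = a + q * n..<a + Suc q * n. of_bool (x mod n \<in> S))"
    by (rule sum.atLeastLessThan_concat[symmetric]) auto
  with one Suc show ?case by (simp add: algebra_simps)
qed simp

lemma residue_in_stopping_set: "0 < x \<Longrightarrow> x mod n \<in> S \<Longrightarrow> x \<in> stopping_set n S"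
proof -
  assume "0 < x" "x mod n \<in> S"
  moreover have "int x = int (x div n) * int n + int (x mod n)"
    by (metis div_mult_mod_eq of_nat_add of_nat_mult)
  ultimately show ?thesis unfolding stopping_set_def by blast
qed

lemma one_in_stopping_set: "1 \<in> stopping_set n S"
  by (simp add: stopping_set_def)

section \<open>Number of ending sticks of one stick\<close>

text \<open>
  Both bounds are preserved by the recursion over the first cut. The bound \<open>l\<close> is conservation of
  length, and settles \<open>l \<le> 2 n\<^sup>2\<close>. For longer sticks, if \<open>C\<close> bounds the expected number for the pieces
  and \<open>d\<close> of the \<open>m = l - 1\<close> possible pieces are dead, then the new value is at most
  \<open>(2 / m) (C m - (C - 1) d)\<close>. This is at most \<open>C\<close> as soon as \<open>d\<close> exceeds \<open>m / 2\<close> by a small margin.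
  As \<open>2 s \<ge> n + 1\<close>, each full period of residues contributes at least 1 to \<open>2 d - m\<close>, while the
  incomplete last period costs less than \<open>n\<close>; from \<open>2 n\<close> periods on, the gain wins.
\<close>
lemma expected_number_le:
  fixes n :: nat and S :: "nat set"
  defines "D \<equiv> stopping_set n S"
  assumes "n \<ge> 2" "S \<subseteq> {0..n - 1}" "real (card S) > real n / 2" "0 < l"
  shows "frag_exp D k [l] (total_weight (\<lambda>_. 1)) \<le> min (real l) (2 * real n ^ 2)"
  using assms(5)
proof (induction k arbitrary: l)
  case 0
  have "(2::real) ^ 2 \<le> real n ^ 2" using assms(2) by (intro power_mono) auto
  then show ?case using 0 by simp
next
  case (Suc k)
  let ?G = "\<lambda>x. frag_exp D k [x] (total_weight (\<lambda>_. 1))"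
  define C where "C = 2 * real n ^ 2"
  have C4: "C \<ge> 4" using power_mono[of 2 "real n" 2] assms(2) unfolding C_def by simp
  have D1: "1 \<in> D" unfolding D_def by (rule one_in_stopping_set)
  show ?case
  proof (cases "l \<in> D")
    case True
    then show ?thesis unfolding frag_exp_total_dead[OF True]
      using C4 Suc.prems by (simp add: C_def)
  next
    case False
    define m where "m = l - 1"
    have "l \<noteq> 1" using False D1 by auto
    then have m: "l = Suc m" "0 < m" using Suc.prems by (auto simp: m_def)
    have rec: "frag_exp D (Suc k) [l] (total_weight (\<lambda>_. 1)) = 2 / real m * (\<Sum>x = 1..m. ?G x)"
      using frag_exp_total_alive[OF D1 Suc.prems False] by (simp add: m_def)
    have "(\<Sum>x = 1..m. ?G x) \<le> (\<Sum>x = 1..m. real x)"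
      by (rule sum_mono) (use Suc.IH in auto)
    also have "\<dots> = real m * real l / 2"
      using double_gauss_sum_from_Suc_0[of m, where 'a = real] m by (simp add: algebra_simps)
    finally have le_l: "frag_exp D (Suc k) [l] (total_weight (\<lambda>_. 1)) \<le> real l"
      unfolding rec using m(2) by (simp add: field_simps)
    have "2 / real m * (\<Sum>x = 1..m. ?G x) \<le> C" if large: "C < real l"
    proof -
      define q where "q = m div n"
      have n0: "0 < n" using assms(2) by simp
      have "real (2 * n ^ 2) < real l" using large by (simp add: C_def)
      then have "2 * n ^ 2 < l" by (simp only: of_nat_less_iff)
      then have "2 * n * n \<le> m" using m by (simp add: power2_eq_square)
      then have "2 * n \<le> q" unfolding q_def using n0
        by (simp add: less_eq_div_iff_mult_less_eq)
      then have q2: "2 * real n \<le> real q" by linarith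
      have "q * n \<le> m" unfolding q_def by simp
      have "m < q * n + n" unfolding q_def
        by (metis add.commute dividend_less_div_times n0)
      then have mq: "real m \<le> real q * real n + real n"
        by (metis less_imp_le of_nat_add of_nat_mult of_nat_le_iff)
      have "(\<Sum>x = 1..m. ?G x) \<le> (\<Sum>x = 1..m. C - (C - 1) * of_bool (x mod n \<in> S))"
      proof (rule sum_mono)
        fix x assume x: "x \<in> {1..m}"
        show "?G x \<le> C - (C - 1) * of_bool (x mod n \<in> S)"
        proof (cases "x mod n \<in> S")
          case True
          then show ?thesis using x residue_in_stopping_set[of x n S]
            by (simp add: frag_exp_total_dead D_def)
        next
          case False
          then show ?thesis using Suc.IH[of x] x by (simp add: C_def)
        qed
      qed
      also have "\<dots> = C * real m - (C - 1) * (\<Sum>x = 1..m. of_bool (x mod n \<in> S))"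
        by (simp add: sum_subtractf sum_distrib_left)
      also have "\<dots> \<le> C * real m - (C - 1) * (real q * real (card S))"
      proof -
        have "real q * real (card S) = (\<Sum>x = 1..<1 + q * n. of_bool (x mod n \<in> S))"
          using sum_residues_window[OF n0 assms(3), of 1 q] by simp
        also have "\<dots> \<le> (\<Sum>x = 1..m. of_bool (x mod n \<in> S))"
          using \<open>q * n \<le> m\<close> by (intro sum_mono2) auto
        finally show ?thesis using C4 by (simp add: mult_left_mono)
      qed
      finally have s: "(\<Sum>x = 1..m. ?G x) \<le> C * real m - (C - 1) * (real q * real (card S))" .
      have "n + 1 \<le> 2 * card S" using assms(4) by linarith
      then have "real n + 1 \<le> 2 * real (card S)" by linarith
      then have "(C - 1) * (real q * (real n + 1)) \<le> (C - 1) * (real q * (2 * real (card S)))"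
        using C4 by (intro mult_left_mono) auto
      moreover have "C * real m \<le> C * (real q * real n + real n)"
        using mq C4 by (intro mult_left_mono) auto
      moreover have "C * (2 * real n) \<le> C * real q"
        using q2 C4 by (intro mult_left_mono) auto
      moreover have "(real n + 1) * real q \<le> real n ^ 2 * real q"
      proof (rule mult_right_mono)
        have "2 * real n \<le> real n * real n" using assms(2) by (intro mult_right_mono) auto
        then show "real n + 1 \<le> real n ^ 2" using assms(2) unfolding power2_eq_square by linarith
      qed simp
      ultimately have "C * real m \<le> 2 * ((C - 1) * (real q * real (card S)))"
        unfolding C_def by (simp add: algebra_simps)
      with s have "2 * (\<Sum>x = 1..m. ?G x) \<le> C * real m" by linarith
      then show ?thesis using m(2) by (simp add: field_simps)
    qed
    then show ?thesis using le_l rec unfolding C_def by linarith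
  qed
qed

text \<open>
  Only the sticks that die at the first cut are counted. The upper half of the full periods below
  \<open>L\<close> lies above \<open>L / 3\<close> once \<open>L \<ge> 4 n\<close>: it reaches down to about \<open>L / 2\<close>, and the margin absorbs
  the rounding.
\<close>
lemma expected_number_top_third_ge:
  fixes n :: nat and S :: "nat set" and L :: nat
  defines "D \<equiv> stopping_set n S"
  assumes "n \<ge> 2" "S \<subseteq> {0..n - 1}" "L \<notin> D" "4 * n \<le> L"
  shows "frag_exp D (Suc k) [L] (total_weight (\<lambda>x. of_bool (L < 3 * x \<and> x \<le> L))) \<ge> real (card S) / (2 * real n)"
proof -
  let ?w = "\<lambda>x. of_bool (L < 3 * x \<and> x \<le> L) :: real"
  have D1: "1 \<in> D" unfolding D_def by (rule one_in_stopping_set)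
  have n0: "0 < n" and L0: "0 < L" "1 < L" using assms(2,5) by auto
  define Q where "Q = L div n"
  define p where "p = Q div 2"
  define a where "a = (Q - p) * n"
  have QL: "Q * n \<le> L" "L < Q * n + n" unfolding Q_def using n0
    by (auto simp: add.commute dividend_less_div_times)
  \<comment> \<open>The window \<open>{a..<a + p * n}\<close> consists of the last \<open>p\<close> full periods below \<open>Q * n \<le> L\<close>.\<close>
  have "p \<le> Q - p" "p \<le> Q" unfolding p_def by auto
  have aQ: "a + p * n = Q * n" unfolding a_def using \<open>p \<le> Q\<close>
    by (metis add_mult_distrib le_add_diff_inverse2)
  have "p * n \<le> a" unfolding a_def using \<open>p \<le> Q - p\<close> by (rule mult_le_mono1)
  then have a3: "L < 3 * a" using aQ QL assms(5) by linarith
  have "Q \<le> 2 * p + 1" unfolding p_def by auto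
  then have "Q * n \<le> (2 * p + 1) * n" by (rule mult_le_mono1)
  then have "Q * n \<le> 2 * (p * n) + n" by (simp add: algebra_simps)
  then have "L \<le> 4 * (p * n)" using QL assms(5) by linarith
  then have "real L \<le> real (4 * (p * n))" by (simp only: of_nat_le_iff)
  then have "real L \<le> 4 * (real p * real n)" by simp
  then have pL: "real L / (4 * real n) \<le> real p"
    using n0 by (simp add: field_simps)
  have nonneg: "0 \<le> frag_exp D k [x] (total_weight ?w)" for x
    by (intro integral_nonneg_AE AE_I2 sum_list_nonneg) auto
  have "real p * real (card S) = (\<Sum>x = a..<a + p * n. of_bool (x mod n \<in> S))"
    using sum_residues_window[OF n0 assms(3), of a p] by simp
  also have "\<dots> \<le> (\<Sum>x = a..<a + p * n. frag_exp D k [x] (total_weight ?w))"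
  proof (rule sum_mono)
    fix x assume x: "x \<in> {a..<a + p * n}"
    show "of_bool (x mod n \<in> S) \<le> frag_exp D k [x] (total_weight ?w)"
    proof (cases "x mod n \<in> S")
      case True
      moreover have "L < 3 * x" "x \<le> L" "0 < x" using x a3 aQ QL by auto
      ultimately show ?thesis using residue_in_stopping_set[of x n S]
        by (simp add: frag_exp_total_dead D_def)
    next
      case False
      then show ?thesis using nonneg by simp
    qed
  qed
  also have "\<dots> \<le> (\<Sum>x = 1..L - 1. frag_exp D k [x] (total_weight ?w))"
    using aQ QL a3 nonneg by (intro sum_mono2) auto
  finally have "real L / (4 * real n) * real (card S) \<le> (\<Sum>x = 1..L - 1. frag_exp D k [x] (total_weight ?w))"
    using pL mult_right_mono[OF pL, of "real (card S)"] by linarith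
  then have "2 / real (L - 1) * (real L / (4 * real n) * real (card S)) \<le> frag_exp D (Suc k) [L] (total_weight ?w)"
    unfolding frag_exp_total_alive[OF D1 L0(1) assms(4)] by (intro mult_left_mono) auto
  moreover have "real (card S) / (2 * real n) \<le> 2 / real (L - 1) * (real L / (4 * real n) * real (card S))"
    using L0 n0 by (simp add: field_simps mult_right_mono)
  ultimately show ?thesis by (rule order_trans[rotated])
qed

section \<open>From expected counts to the expected proportion\<close>

text \<open>The right-hand side is convex in \<open>N\<close>; the left-hand side is its tangent at \<open>\<mu>\<close>.\<close>
lemma inverse_ge_tangent:
  fixes N \<mu> :: real
  assumes "0 < N" "0 < \<mu>"
  shows "2 / \<mu> - N / \<mu> ^ 2 \<le> 1 / N"
proof -
  have "1 / N - (2 / \<mu> - N / \<mu> ^ 2) = (\<mu> - N) ^ 2 / (N * \<mu> ^ 2)"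
    using assms by (simp add: field_simps power2_eq_square)
  also have "\<dots> \<ge> 0" using assms by simp
  finally show ?thesis by simp
qed

text \<open>
  With \<open>U\<close> the total \<open>u\<close>-weight, \<open>a\<close> its expectation for one stick and \<open>\<mu> = R C\<close>, the tangent bound
  yields \<open>E (U / N) \<ge> 2 E U / \<mu> - E (U N) / \<mu>\<^sup>2\<close>. Here \<open>E U = R a\<close>, and
  \<open>E (U N) \<le> R\<^sup>2 a C + R L\<^sup>2\<close>, where the second term bounds the diagonal, as one stick of length \<open>L\<close>
  never gives more than \<open>L\<close> sticks.
\<close>
lemma expected_proportion_ge:
  fixes D :: "nat set" and u :: "nat \<Rightarrow> real"
  defines "N \<equiv> total_weight (\<lambda>_. 1)"
  assumes "1 \<in> D" "0 < L" "0 < R" and u: "\<And>x. 0 \<le> u x" "\<And>x. u x \<le> 1"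
    and C: "0 < C" "frag_exp D k [L] N \<le> C"
  shows "frag_exp D k [L] (total_weight u) / C - real L ^ 2 / (real R * C ^ 2)
           \<le> frag_exp D k (replicate R L) (\<lambda>xs. total_weight u xs / N xs)"
proof -
  let ?U = "total_weight u"
  define a where "a = frag_exp D k [L] ?U"
  define \<mu> where "\<mu> = real R * C"
  have \<mu>: "0 < \<mu>" using assms by (simp add: \<mu>_def)
  have U0: "0 \<le> ?U xs" for xs using u(1) by (intro sum_list_nonneg) auto
  have UN: "?U xs \<le> N xs" for xs unfolding N_def using u(2) by (intro sum_list_mono) auto
  have N0: "0 \<le> N xs" for xs unfolding N_def by (intro sum_list_nonneg) auto
  have a0: "0 \<le> a" unfolding a_def using U0 by (intro integral_nonneg_AE AE_I2)
  have pos: "0 \<notin> set (replicate R L)" "0 \<notin> set [L]" using assms(3) by auto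
  have sq: "frag_exp D k [L] (\<lambda>xs. ?U xs * N xs) \<le> real L ^ 2"
  proof -
    have "frag_exp D k [L] (\<lambda>xs. ?U xs * N xs) \<le> frag_exp D k [L] (\<lambda>_. real L ^ 2)"
    proof (rule frag_exp_mono[OF assms(2) pos(2)])
      fix ys assume "ys \<in> set_pmf (frag_from D k [L])"
      from frag_from_support[OF assms(2) pos(2) this] length_le_sum_list[of ys]
      have "length ys \<le> L" by simp
      then have "N ys \<le> real L" unfolding N_def by (simp add: sum_list_triv)
      moreover from this have "?U ys \<le> real L" using UN[of ys] by linarith
      ultimately show "?U ys * N ys \<le> real L ^ 2" using U0[of ys] UN[of ys]
        unfolding power2_eq_square by (intro mult_mono) auto
    qed
    then show ?thesis by simp
  qed
  have "frag_exp D k (replicate R L) (\<lambda>xs. ?U xs * N xs) \<le> real R * real L ^ 2 + real R ^ 2 * (a * C)"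
  proof -
    have "frag_exp D k (replicate R L) (\<lambda>xs. ?U xs * N xs) =
       real R * frag_exp D k [L] (\<lambda>zs. ?U zs * N zs) +
         real R * (real R - 1) * (a * frag_exp D k [L] N)"
      unfolding N_def a_def by (rule frag_exp_product_replicate[OF assms(2,3)])
    also have "\<dots> \<le> real R * real L ^ 2 + real R ^ 2 * (a * C)"
    proof (rule add_mono)
      show "real R * frag_exp D k [L] (\<lambda>zs. ?U zs * N zs) \<le> real R * real L ^ 2"
        using sq by (rule mult_left_mono) simp
      have "0 \<le> frag_exp D k [L] N" using N0 by (intro integral_nonneg_AE AE_I2)
      then have "0 \<le> a * frag_exp D k [L] N" using a0 by (rule mult_nonneg_nonneg[rotated])
      moreover have "real R * (real R - 1) \<le> real R ^ 2"
        by (simp add: power2_eq_square mult_left_mono)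
      ultimately have "real R * (real R - 1) * (a * frag_exp D k [L] N)
          \<le> real R ^ 2 * (a * frag_exp D k [L] N)"
        by (rule mult_right_mono[rotated])
      also have "\<dots> \<le> real R ^ 2 * (a * C)"
        using C(2) a0 by (intro mult_left_mono) auto
      finally show "real R * (real R - 1) * (a * frag_exp D k [L] N) \<le> real R ^ 2 * (a * C)" .
    qed
    finally show ?thesis .
  qed
  then have "frag_exp D k (replicate R L) (\<lambda>xs. ?U xs * N xs) / \<mu> ^ 2 \<le>
     (real R * real L ^ 2 + real R ^ 2 * (a * C)) / \<mu> ^ 2"
    by (intro divide_right_mono) auto
  also have "\<dots> = real L ^ 2 / (real R * C ^ 2) + a / C"
    using assms(4) C(1) unfolding \<mu>_def by (simp add: field_simps power2_eq_square)
  finally have prod: "frag_exp D k (replicate R L) (\<lambda>xs. ?U xs * N xs) / \<mu> ^ 2 \<le>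
      real L ^ 2 / (real R * C ^ 2) + a / C" .
  have "frag_exp D k (replicate R L) ?U * (2 / \<mu>) = 2 * a / C"
    using frag_exp_total_replicate[OF assms(2,3), of k R u] assms(4) C(1)
    by (simp add: \<mu>_def a_def field_simps)
  with prod have "a / C - real L ^ 2 / (real R * C ^ 2) \<le> frag_exp D k (replicate R L) ?U * (2 / \<mu>)
      - frag_exp D k (replicate R L) (\<lambda>xs. ?U xs * N xs) / \<mu> ^ 2"
    by simp
  also have "\<dots> = frag_exp D k (replicate R L) (\<lambda>xs. ?U xs * (2 / \<mu>) - (?U xs * N xs) / \<mu> ^ 2)"
    by (subst Bochner_Integration.integral_diff)
       (simp_all only: integrable_frag_from[OF assms(2) pos(1)]
          integral_mult_left_zero integral_divide_zero)
  also have "\<dots> \<le> frag_exp D k (replicate R L) (\<lambda>xs. ?U xs / N xs)"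
  proof (rule frag_exp_mono[OF assms(2) pos(1)])
    fix ys
    show "?U ys * (2 / \<mu>) - ?U ys * N ys / \<mu> ^ 2 \<le> ?U ys / N ys"
    proof (cases "N ys > 0")
      case True
      from mult_left_mono[OF inverse_ge_tangent[OF True \<mu>] U0[of ys]] show ?thesis
        by (simp add: algebra_simps)
    next
      case False
      then have "?U ys = 0" using U0[of ys] UN[of ys] by linarith
      then show ?thesis by simp
    qed
  qed
  finally show ?thesis unfolding a_def .
qed

section \<open>The window on the circle of mantissas\<close>

text \<open>
  Modulo 1 an interval shorter than 1 ending at \<open>z\<close> becomes either one interval ending at \<open>frac z\<close>
  or, if it contains an integer, two pieces at the two ends of \<open>[0, 1)\<close>.
\<close>
lemma frac_window:
  fixes y z \<delta> :: real
  assumes "z - \<delta> < y" "y \<le> z" "\<delta> < 1"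
  shows "if \<delta> \<le> frac z then frac z - \<delta> < frac y \<and> frac y \<le> frac z
         else frac y \<le> frac z \<or> 1 + frac z - \<delta> < frac y"
proof (cases "of_int \<lfloor>z\<rfloor> \<le> y")
  case True
  then have "\<lfloor>y\<rfloor> = \<lfloor>z\<rfloor>" using assms by linarith
  then show ?thesis using assms by (auto simp: frac_def)
next
  case False
  then have "\<lfloor>y\<rfloor> = \<lfloor>z\<rfloor> - 1" using assms by linarith
  then show ?thesis using assms False by (auto simp: frac_def)
qed

text \<open>
  Polya's argument: on a finite grid of mesh \<open>1 / K\<close> the convergence is uniform, and between the
  two neighbouring grid points monotonicity confines \<open>F j t\<close> up to the mesh.
\<close>
lemma monotone_converges_to_id_uniformly:
  fixes F :: "nat \<Rightarrow> real \<Rightarrow> real"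
  assumes mono: "\<And>j s t. s \<le> t \<Longrightarrow> F j s \<le> F j t"
    and lim: "\<And>t. t \<in> {0..1} \<Longrightarrow> (\<lambda>j. F j t) \<longlonglongrightarrow> t"
    and "0 < \<epsilon>"
  shows "\<forall>\<^sub>F j in sequentially. \<forall>t\<in>{0..1}. \<bar>F j t - t\<bar> < \<epsilon>"
proof -
  obtain K :: nat where K: "2 / \<epsilon> < real K" using reals_Archimedean2 by blast
  then have K0: "0 < real K" using assms(3) by (meson divide_pos_pos less_trans zero_less_numeral)
  then have K1: "1 / real K < \<epsilon> / 2" using K assms(3) by (simp add: field_simps)
  have "\<forall>\<^sub>F j in sequentially. \<forall>i\<in>{..K}. dist (F j (real i / real K)) (real i / real K) < \<epsilon> / 2"
    using assms(3) K0 by (intro eventually_ball_finite ballI tendstoD lim) auto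
  then show ?thesis
  proof eventually_elim
    case (elim j)
    show ?case
    proof
      fix t :: real assume t: "t \<in> {0..1}"
      define i where "i = nat \<lfloor>t * real K\<rfloor>"
      define i' where "i' = nat \<lceil>t * real K\<rceil>"
      have tK: "0 \<le> t * real K" "t * real K \<le> real K" using t K0 by (auto intro: mult_left_le_one_le)
      have "real i \<le> t * real K" "t * real K \<le> real i + 1" "t * real K \<le> real i'" "real i' \<le> t * real K + 1"
        "i \<le> K" "i' \<le> K"
        unfolding i_def i'_def using tK by linarith+
      then have le: "real i / real K \<le> t" "t \<le> real i' / real K"
         "t \<le> real i / real K + 1 / real K" "real i' / real K \<le> t + 1 / real K"
        using K0 by (simp_all add: field_simps)
      moreover have "\<bar>F j (real i / real K) - real i / real K\<bar> < \<epsilon> / 2"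
          "\<bar>F j (real i' / real K) - real i' / real K\<bar> < \<epsilon> / 2"
        using elim \<open>i \<le> K\<close> \<open>i' \<le> K\<close> by (auto simp: dist_real_def)
      ultimately show "\<bar>F j t - t\<bar> < \<epsilon>"
        using mono[OF le(1), of j] mono[OF le(2), of j] K1 by linarith
    qed
  qed
qed

lemma mantissa_proportion_eq:
  "mantissa_proportion B t xs =
     total_weight (\<lambda>l. of_bool (mantissa B (real l) \<le> t)) xs / total_weight (\<lambda>_. 1) xs"
proof -
  have "real (length (filter (\<lambda>l. mantissa B (real l) \<le> t) xs)) =
      total_weight (\<lambda>l. of_bool (mantissa B (real l) \<le> t)) xs"
    by (induction xs) auto
  then show ?thesis by (simp add: mantissa_proportion_def sum_list_triv)
qed

lemma mantissa_proportion_mono: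
  "s \<le> t \<Longrightarrow> mantissa_proportion B s xs \<le> mantissa_proportion B t xs"
  unfolding mantissa_proportion_eq
  by (intro divide_right_mono sum_list_mono sum_list_nonneg) auto

text \<open>
  In the case where the arc wraps around 0, the value at 1 stands for the proportion of all sticks.
  Using it instead of the number 1 avoids any case distinction for the empty collection.
\<close>
lemma top_third_proportion_le:
  fixes L :: nat
  assumes "3 < B" "0 < L"
  defines "\<theta> \<equiv> mantissa B (real L)" and "\<delta> \<equiv> log B 3"
    and "W \<equiv> \<lambda>xs. total_weight (\<lambda>x. of_bool (L < 3 * x \<and> x \<le> L)) xs / total_weight (\<lambda>_. 1) xs"
  shows "W xs \<le> (if \<delta> \<le> \<theta>
      then mantissa_proportion B \<theta> xs - mantissa_proportion B (\<theta> - \<delta>) xs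
      else mantissa_proportion B \<theta> xs + mantissa_proportion B 1 xs - mantissa_proportion B (1 + \<theta> - \<delta>) xs)"
proof -
  let ?m = "\<lambda>x::nat. mantissa B (real x)"
  have \<delta>: "0 < \<delta>" "\<delta> < 1" unfolding \<delta>_def using assms(1) by simp_all
  have window: "if \<delta> \<le> \<theta> then \<theta> - \<delta> < ?m x \<and> ?m x \<le> \<theta> else ?m x \<le> \<theta> \<or> 1 + \<theta> - \<delta> < ?m x"
    if x: "L < 3 * x" "x \<le> L" for x
  proof -
    have x0: "0 < real x" using x assms(2) by (cases x) auto
    have "real L < 3 * real x" using x(1) by linarith
    then have "log B (real L) < log B (3 * real x)" using assms by simp
    also have "\<dots> = \<delta> + log B (real x)" unfolding \<delta>_def using x0 by (simp add: log_mult)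
    finally have "log B (real L) - \<delta> < log B (real x)" by simp
    moreover have "log B (real x) \<le> log B (real L)" using x x0 assms by simp
    ultimately show ?thesis using \<delta>(2) unfolding \<theta>_def mantissa_def by (rule frac_window)
  qed
  have m1: "?m x \<le> 1" for x unfolding mantissa_def using frac_lt_1 less_imp_le by blast
  show ?thesis
  proof (cases "\<delta> \<le> \<theta>")
    case True
    have "of_bool (L < 3 * x \<and> x \<le> L) \<le>
      of_bool (?m x \<le> \<theta>) - (of_bool (?m x \<le> \<theta> - \<delta>) :: real)" for x
      using window[of x] True \<delta> by (auto simp: of_bool_def)
    then have "total_weight (\<lambda>x. of_bool (L < 3 * x \<and> x \<le> L)) xs \<le>
      total_weight (\<lambda>x. of_bool (?m x \<le> \<theta>) - of_bool (?m x \<le> \<theta> - \<delta>)) xs"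
      by (intro sum_list_mono) auto
    then show ?thesis using True
      unfolding W_def mantissa_proportion_eq
      by (auto simp: sum_list_subtractf sum_list_triv divide_right_mono simp flip: diff_divide_distrib)
  next
    case False
    have "of_bool (L < 3 * x \<and> x \<le> L) \<le>
      of_bool (?m x \<le> \<theta>) + of_bool (?m x \<le> 1) - (of_bool (?m x \<le> 1 + \<theta> - \<delta>) :: real)" for x
      using window[of x] m1[of x] False by (auto simp: of_bool_def)
    then have "total_weight (\<lambda>x. of_bool (L < 3 * x \<and> x \<le> L)) xs \<le>
      total_weight (\<lambda>x. of_bool (?m x \<le> \<theta>) + of_bool (?m x \<le> 1) - of_bool (?m x \<le> 1 + \<theta> - \<delta>)) xs"
      by (intro sum_list_mono) auto
    then show ?thesis using False
      unfolding W_def mantissa_proportion_eq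
      by (auto simp: sum_list_subtractf sum_list_addf sum_list_triv divide_right_mono simp flip: diff_divide_distrib add_divide_distrib)
  qed
qed

section \<open>Non-convergence\<close>

theorem theorem5p16:
  fixes n :: nat and S :: "nat set" and B :: real and L R :: "nat \<Rightarrow> nat"
  assumes "n \<ge> 2"
    and "S \<subseteq> {0..n - 1}"
    and "real (card S) > real n / 2"
    and "B > 3 powr (6 * real n ^ 3 / real (card S))"
    and "\<And>j. L j > 0"
    and "\<And>j. L j \<notin> stopping_set n S"
    and "filterlim L at_top sequentially"
    and "filterlim (\<lambda>j. real (R j) / real (L j) ^ 2) at_top sequentially"
  shows "\<not> mantissas_converge_to_uniform B (stopping_set n S) L R"
proof
  assume conv: "mantissas_converge_to_uniform B (stopping_set n S) L R"
  define D where "D = stopping_set n S"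
  define C where "C = 2 * real n ^ 2"
  \<comment> \<open>In units of \<open>\<eta>\<close> the arc is shorter than 2, while its expected share is at least 3 up to an error
    that vanishes in the limit; below each of the two bounds loses \<open>\<eta> / 2\<close>.\<close>
  define \<eta> where "\<eta> = real (card S) / (12 * real n ^ 3)"
  define F where "F = (\<lambda>j t. frag_exp D (L j) (replicate (R j) (L j)) (mantissa_proportion B t))"
  have n0: "0 < real n" "0 < real (card S)" using assms(1,3) by auto
  have C0: "0 < C" using n0 by (simp add: C_def)
  have \<eta>0: "0 < \<eta>" using n0 by (simp add: \<eta>_def)
  have D1: "1 \<in> D" unfolding D_def by (rule one_in_stopping_set)
  have "card S \<le> n" using card_mono[OF _ assms(2)] assms(1) by simp
  moreover have "real n \<le> real n ^ 3" using assms(1) by (intro self_le_power) auto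
  ultimately have "real (card S) \<le> 6 * real n ^ 3" using n0 by linarith
  then have ge1: "1 \<le> 6 * real n ^ 3 / real (card S)"
    using n0 by (simp only: le_divide_eq_1_pos)
  have "(3::real) powr 1 \<le> 3 powr (6 * real n ^ 3 / real (card S))"
    using ge1 by (intro powr_mono) auto
  then have B3: "3 < B" using assms(4) by simp
  have "6 * real n ^ 3 / real (card S) < log 3 B"
    using assms(4) B3 by (simp add: less_log_iff)
  moreover have "log B 3 = 1 / log 3 B" using B3 by (simp add: log_def)
  moreover have "1 / log 3 B < 1 / (6 * real n ^ 3 / real (card S))"
    using calculation ge1 by (intro divide_strict_left_mono mult_pos_pos) linarith+
  ultimately have \<delta>: "log B 3 < 2 * \<eta>" by (simp add: \<eta>_def)
  have \<delta>0: "0 < log B 3" "log B 3 < 1" using B3 by auto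
  have pos: "0 \<notin> set (replicate (R j) (L j))" for j using assms(5)[of j] by auto
  have "F j s \<le> F j t" if "s \<le> t" for j s t
    unfolding F_def by (intro frag_exp_mono[OF D1 pos] mantissa_proportion_mono that)
  moreover have "(\<lambda>j. F j t) \<longlonglongrightarrow> t" if "t \<in> {0..1}" for t
    using conv that unfolding mantissas_converge_to_uniform_def F_def D_def
      ending_sticks_def frag_level_eq_frag_from by blast
  ultimately have unif: "\<forall>\<^sub>F j in sequentially. \<forall>t\<in>{0..1}. \<bar>F j t - t\<bar> < \<eta> / 6"
    using \<eta>0 by (intro monotone_converges_to_id_uniformly) auto
  have "\<forall>\<^sub>F j in sequentially. 4 * n \<le> L j"
    using assms(7) by (simp add: filterlim_at_top)
  moreover have "\<forall>\<^sub>F j in sequentially. max 1 (2 / (\<eta> * C ^ 2)) \<le> real (R j) / real (L j) ^ 2"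
    using assms(8) by (simp only: filterlim_at_top)
  ultimately have "\<forall>\<^sub>F j in sequentially. False"
    using unif
  proof eventually_elim
    case (elim j)
    let ?w = "\<lambda>x. of_bool (L j < 3 * x \<and> x \<le> L j) :: real"
    let ?W = "\<lambda>xs. total_weight ?w xs / total_weight (\<lambda>_. 1) xs"
    let ?E = "frag_exp D (L j) (replicate (R j) (L j))"
    define \<theta> where "\<theta> = mantissa B (real (L j))"
    have L0: "0 < L j" by (rule assms(5))
    have R0: "0 < R j" using elim(2) by (cases "R j") auto
    have \<theta>: "0 \<le> \<theta>" "\<theta> < 1" unfolding \<theta>_def mantissa_def by (auto simp: frac_lt_1)
    have err: "real (L j) ^ 2 / (real (R j) * C ^ 2) \<le> \<eta> / 2"
      using elim(2) L0 R0 C0 \<eta>0 by (simp add: field_simps)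
    have "real (card S) / (2 * real n) \<le> frag_exp D (Suc (L j - 1)) [L j] (total_weight ?w)"
      unfolding D_def by (intro expected_number_top_third_ge assms elim)
    then have "real (card S) / (2 * real n) / C \<le> frag_exp D (L j) [L j] (total_weight ?w) / C"
      using L0 C0 by (intro divide_right_mono) auto
    moreover have "real (card S) / (2 * real n) / C = 3 * \<eta>"
      using n0 unfolding C_def \<eta>_def by (simp add: field_simps power2_eq_square power3_eq_cube)
    moreover have "frag_exp D (L j) [L j] (total_weight ?w) / C - real (L j) ^ 2 / (real (R j) * C ^ 2)
        \<le> ?E ?W"
      using expected_number_le[OF assms(1-3) L0, of "L j"] unfolding D_def[symmetric] C_def[symmetric]
      by (intro expected_proportion_ge D1 L0 R0 C0) auto
    ultimately have low: "3 * \<eta> - \<eta> / 2 \<le> ?E ?W" using err by linarith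
    have int: "integrable (measure_pmf (frag_from D (L j) (replicate (R j) (L j)))) h" for h :: "nat list \<Rightarrow> real"
      by (rule integrable_frag_from[OF D1 pos])
    have close: "\<bar>F j t - t\<bar> < \<eta> / 6" if "0 \<le> t" "t \<le> 1" for t using elim(3) that by auto
    have up: "?E ?W \<le> log B 3 + \<eta> / 2"
    proof (cases "log B 3 \<le> \<theta>")
      case True
      have "?E ?W \<le> ?E (\<lambda>xs. mantissa_proportion B \<theta> xs - mantissa_proportion B (\<theta> - log B 3) xs)"
        using top_third_proportion_le[OF B3 L0] True
        by (intro frag_exp_mono[OF D1 pos]) (simp add: \<theta>_def)
      also have "\<dots> = F j \<theta> - F j (\<theta> - log B 3)"
        unfolding F_def using int by simp
      finally show ?thesis
        using close[of \<theta>] close[of "\<theta> - log B 3"] \<theta> \<delta>0 True by linarith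
    next
      case False
      have "?E ?W \<le> ?E (\<lambda>xs. mantissa_proportion B \<theta> xs + mantissa_proportion B 1 xs
            - mantissa_proportion B (1 + \<theta> - log B 3) xs)"
        using top_third_proportion_le[OF B3 L0] False
        by (intro frag_exp_mono[OF D1 pos]) (simp add: \<theta>_def)
      also have "\<dots> = F j \<theta> + F j 1 - F j (1 + \<theta> - log B 3)"
        unfolding F_def using int by simp
      finally show ?thesis
        using close[of \<theta>] close[of 1] close[of "1 + \<theta> - log B 3"] \<theta> \<delta>0 False by linarith
    qed
    show False using low up \<delta> by linarith
  qed
  then show False by simp
qed

end
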